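(* Let $m\ge 4$ and $1\le k\le 2^{m-3}-1$ be integers, and let $p$ be an odd prime with $p\equiv\pm1\pmod 8$ and $p\equiv 8k-1\pmod{2^m}$. Let $\alpha,\beta,\gamma\in Z_{2^m}$ be such that $\alpha+\beta e_1+\gamma e_2$ is an idempotent of $R_p$ with $2\alpha-(\beta+\gamma)\equiv 1\pmod{2^m}$, and assume that $\beta+\gamma\equiv -p\pmod{2^m}$ and $p^2\equiv 1\pmod{2^m}$. Define the cyclic codes (ideals of $R_p$) $$Q_{2^m}=(\alpha+\beta e_1+\gamma e_2),\quad Q'_{2^m}=(\alpha+\beta e_1+\gamma e_2+(8k-1)h),$$ $$N_{2^m}=(\alpha+\gamma e_1+\beta e_2),\quad N'_{2^m}=(\alpha+\gamma e_1+\beta e_2+(8k-1)h).$$ Then: (1) $Q_{2^m}$ and $N_{2^m}$ are equivalent, and $Q'_{2^m}$ and $N'_{2^m}$ are equivalent. (2) $Q'_{2^m}\cap N'_{2^m}=((8k-1)h)$ and $Q'_{2^m}+N'_{2^m}=R_p$. (3) $|Q'_{2^m}|=2^{m(p+1)/2}=|N'_{2^m}|$. (4) $Q'_{2^m}=Q_{2^m}+((8k-1)h)$ and $N'_{2^m}=N_{2^m}+((8k-1)h)$. (5) $|Q_{2^m}|=2^{m(p-1)/2}=|N_{2^m}|$. (6) $Q_{2^m}$ and $N_{2^m}$ are both self-orthogonal, $(Q'_{2^m})^{\perp}=Q_{2^m}$ and $(N'_{2^m})^{\perp}=N_{2^m}$.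
   Context: $Z_{2^m}$ is the ring of integers modulo $2^m$ and $R_p=Z_{2^m}[x]/(x^p-1)$; a polynomial $a_0+a_1x+\cdots+a_{p-1}x^{p-1}$ in $R_p$ is identified with the vector $(a_0,\dots,a_{p-1})\in Z_{2^m}^p$, so that cyclic codes of length $p$ over $Z_{2^m}$ are exactly the ideals of $R_p$. $Q$ and $N$ (without subscript) denote the sets of nonzero quadratic residues and of non-residues modulo $p$; $e_1=\sum_{i\in Q}x^i$, $e_2=\sum_{i\in N}x^i$, and $h=1+e_1+e_2$ is the all-one vector. An idempotent of $R_p$ is an element $e$ with $e^2=e$. $(g)$ denotes the ideal of $R_p$ generated by $g$. Two codes are equivalent if one is obtained from the other by a permutation of the coordinates. The dual is $\mathcal C^\perp=\{u\in Z_{2^m}^p: u\cdot v=0\text{ for all }v\in\mathcal C\}$ for the standard inner product over $Z_{2^m}$, and $\mathcal C$ is self-orthogonal if $\mathcal C\subseteq\mathcal C^\perp$. *)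

theory Defs
  imports "HOL-Algebra.UnivPoly" "HOL-Algebra.QuotRing" "HOL-Number_Theory.Residues"
    "HOL-Combinatorics.Permutations"
begin

definition Zmod :: "nat \<Rightarrow> int ring" where
  "Zmod m = residue_ring (2 ^ m)"

abbreviation Zpoly :: "nat \<Rightarrow> (int, nat \<Rightarrow> int) up_ring" where
  "Zpoly m \<equiv> UP (Zmod m)"

definition cyclic_ideal :: "nat \<Rightarrow> nat \<Rightarrow> (nat \<Rightarrow> int) set" where
  "cyclic_ideal m p =
     PIdl\<^bsub>Zpoly m\<^esub> (monom (Zpoly m) \<one>\<^bsub>Zmod m\<^esub> p \<ominus>\<^bsub>Zpoly m\<^esub> \<one>\<^bsub>Zpoly m\<^esub>)"

definition Rp :: "nat \<Rightarrow> nat \<Rightarrow> (nat \<Rightarrow> int) set ring" where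
  "Rp m p = Zpoly m Quot cyclic_ideal m p"

definition cls :: "nat \<Rightarrow> nat \<Rightarrow> (nat \<Rightarrow> int) \<Rightarrow> (nat \<Rightarrow> int) set" where
  "cls m p f = cyclic_ideal m p +>\<^bsub>Zpoly m\<^esub> f"

definition const :: "nat \<Rightarrow> nat \<Rightarrow> int \<Rightarrow> (nat \<Rightarrow> int) set" where
  "const m p a = cls m p (monom (Zpoly m) a 0)"

definition xpow :: "nat \<Rightarrow> nat \<Rightarrow> nat \<Rightarrow> (nat \<Rightarrow> int) set" where
  "xpow m p i = cls m p (monom (Zpoly m) \<one>\<^bsub>Zmod m\<^esub> i)"

definition quad_res :: "nat \<Rightarrow> nat set" where
  "quad_res p = {i \<in> {1..<p}. QuadRes (int p) (int i)}"

definition quad_nonres :: "nat \<Rightarrow> nat set" where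
  "quad_nonres p = {i \<in> {1..<p}. \<not> QuadRes (int p) (int i)}"

definition e1 :: "nat \<Rightarrow> nat \<Rightarrow> (nat \<Rightarrow> int) set" where
  "e1 m p = (\<Oplus>\<^bsub>Rp m p\<^esub>i\<in>quad_res p. xpow m p i)"

definition e2 :: "nat \<Rightarrow> nat \<Rightarrow> (nat \<Rightarrow> int) set" where
  "e2 m p = (\<Oplus>\<^bsub>Rp m p\<^esub>i\<in>quad_nonres p. xpow m p i)"

definition allone :: "nat \<Rightarrow> nat \<Rightarrow> (nat \<Rightarrow> int) set" where
  "allone m p = \<one>\<^bsub>Rp m p\<^esub> \<oplus>\<^bsub>Rp m p\<^esub> e1 m p \<oplus>\<^bsub>Rp m p\<^esub> e2 m p"

definition comb :: "nat \<Rightarrow> nat \<Rightarrow> int \<Rightarrow> int \<Rightarrow> int \<Rightarrow> (nat \<Rightarrow> int) set" where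
  "comb m p a b c =
     const m p a \<oplus>\<^bsub>Rp m p\<^esub> const m p b \<otimes>\<^bsub>Rp m p\<^esub> e1 m p \<oplus>\<^bsub>Rp m p\<^esub> const m p c \<otimes>\<^bsub>Rp m p\<^esub> e2 m p"

definition idempotent :: "('a, 'b) ring_scheme \<Rightarrow> 'a \<Rightarrow> bool" where
  "idempotent R e \<longleftrightarrow> e \<in> carrier R \<and> e \<otimes>\<^bsub>R\<^esub> e = e"

definition vectors :: "nat \<Rightarrow> nat \<Rightarrow> (nat \<Rightarrow> int) set" where
  "vectors m p = {..<p} \<rightarrow>\<^sub>E carrier (Zmod m)"

definition vec_class :: "nat \<Rightarrow> nat \<Rightarrow> (nat \<Rightarrow> int) \<Rightarrow> (nat \<Rightarrow> int) set" where
  "vec_class m p v = cls m p (\<Oplus>\<^bsub>Zpoly m\<^esub>i\<in>{..<p}. monom (Zpoly m) (v i) i)"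

(* The code in (Z_{2^m})^p that a set of elements of R_p is identified with. *)
definition codewords :: "nat \<Rightarrow> nat \<Rightarrow> (nat \<Rightarrow> int) set set \<Rightarrow> (nat \<Rightarrow> int) set" where
  "codewords m p C = {v \<in> vectors m p. vec_class m p v \<in> C}"

definition equivalent_codes ::
    "nat \<Rightarrow> (nat \<Rightarrow> int) set \<Rightarrow> (nat \<Rightarrow> int) set \<Rightarrow> bool" where
  "equivalent_codes p C D \<longleftrightarrow> (\<exists>\<sigma>. \<sigma> permutes {..<p} \<and> D = (\<lambda>v. v \<circ> \<sigma>) ` C)"

definition inner_prod :: "nat \<Rightarrow> nat \<Rightarrow> (nat \<Rightarrow> int) \<Rightarrow> (nat \<Rightarrow> int) \<Rightarrow> int" where
  "inner_prod m p u v = (\<Oplus>\<^bsub>Zmod m\<^esub>i\<in>{..<p}. u i \<otimes>\<^bsub>Zmod m\<^esub> v i)"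

definition dual_code :: "nat \<Rightarrow> nat \<Rightarrow> (nat \<Rightarrow> int) set \<Rightarrow> (nat \<Rightarrow> int) set" where
  "dual_code m p C = {u \<in> vectors m p. \<forall>v\<in>C. inner_prod m p u v = \<zero>\<^bsub>Zmod m\<^esub>}"

definition self_orthogonal :: "nat \<Rightarrow> nat \<Rightarrow> (nat \<Rightarrow> int) set \<Rightarrow> bool" where
  "self_orthogonal m p C \<longleftrightarrow> C \<subseteq> dual_code m p C"

end

theory Submission
  imports Defs "HOL-Number_Theory.Quadratic_Reciprocity"
begin

text \<open>
Write \<open>e = \<alpha> + \<beta> e\<^sub>1 + \<gamma> e\<^sub>2\<close>, \<open>f = \<alpha> + \<gamma> e\<^sub>1 + \<beta> e\<^sub>2\<close> and \<open>j = p h\<close>; since \<open>p \<equiv> 8 k - 1\<close>, the last is the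
correction term \<open>(8 k - 1) h\<close>. These are three pairwise orthogonal idempotents with sum 1
(\<open>orthogonal_idempotents\<close>). The ring \<open>R\<^sub>p\<close> is therefore the direct sum of the ideals they
generate, and the four codes are the ideals of \<open>e\<close>, \<open>f\<close>, \<open>e + j\<close> and \<open>f + j\<close>. The statements
about intersections, sums and products of cardinalities hold for such idempotents in any commutative ring.

The second ingredient is the automorphism \<open>x \<mapsto> x\<^sup>-\<^sup>1\<close> of \<open>R\<^sub>p\<close>, which permutes the coordinates. As
\<open>p \<equiv> 3 (mod 4)\<close>, the number \<open>-1\<close> is a non-residue, so this automorphism exchanges \<open>e\<^sub>1\<close> and \<open>e\<^sub>2\<close>, hence \<open>e\<close>
and \<open>f\<close>, and fixes \<open>j\<close>. This yields the equivalences, and the equality of cardinalities needed to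
solve \<open>|(e)| |(f)| |(j)| = 2\<^bsup>mp\<^esup>\<close> with \<open>|(j)| = 2\<^sup>m\<close>. It also yields the duals: the dual of the ideal of an
element is the annihilator of its image under this automorphism (\<open>dual_code_PIdl\<close>), and the annihilator of
\<open>f + j = 1 - e\<close> is the ideal of \<open>e\<close>; self-orthogonality is the relation \<open>e f = 0\<close>.

To compute in the quotient ring, its elements are represented by integer coefficient functions, with
cyclic convolution as product (\<open>of_vec_eq_iff\<close>, \<open>of_vec_mult\<close>, \<open>of_vec_surj\<close>).
\<close>

section \<open>Orthogonal idempotents in a commutative ring\<close>

context cring
begin

text \<open>
Multiplication by an idempotent is a projection onto the ideal it generates. Membership thus becomes
an equation, and in this form all the ideals below are compared.
\<close>
lemma cgenideal_idempotent:
  assumes "e \<in> carrier R" "e \<otimes> e = e"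
  shows "PIdl e = {x \<in> carrier R. x \<otimes> e = x}"
proof (intro equalityI subsetI)
  fix x assume "x \<in> PIdl e"
  then show "x \<in> {x \<in> carrier R. x \<otimes> e = x}"
    unfolding cgenideal_def using assms by (auto simp: m_assoc)
next
  fix x assume "x \<in> {x \<in> carrier R. x \<otimes> e = x}"
  then have "x \<in> carrier R" "x = x \<otimes> e" by simp_all
  then show "x \<in> PIdl e" unfolding cgenideal_def by blast
qed

lemma orthogonal_idempotent_add:
  assumes "e \<in> carrier R" "e \<otimes> e = e" "j \<in> carrier R" "j \<otimes> j = j" "e \<otimes> j = \<zero>"
  shows "(e \<oplus> j) \<otimes> (e \<oplus> j) = e \<oplus> j"
  using assms m_comm[of e j] by (simp add: l_distr r_distr)

lemma cgenideal_orthogonal_add: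
  assumes e: "e \<in> carrier R" "e \<otimes> e = e" and j: "j \<in> carrier R" "j \<otimes> j = j"
    and ej: "e \<otimes> j = \<zero>"
  shows "PIdl (e \<oplus> j) = PIdl e <+>\<^bsub>R\<^esub> PIdl j"
proof
  show "PIdl (e \<oplus> j) \<subseteq> PIdl e <+>\<^bsub>R\<^esub> PIdl j"
  proof
    fix z assume "z \<in> PIdl (e \<oplus> j)"
    then obtain x where "x \<in> carrier R" "z = x \<otimes> e \<oplus> x \<otimes> j"
      unfolding cgenideal_def using e j by (auto simp: r_distr)
    then show "z \<in> PIdl e <+>\<^bsub>R\<^esub> PIdl j"
      unfolding cgenideal_def set_add_def' by blast
  qed
  show "PIdl e <+>\<^bsub>R\<^esub> PIdl j \<subseteq> PIdl (e \<oplus> j)"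
  proof
    fix z assume "z \<in> PIdl e <+>\<^bsub>R\<^esub> PIdl j"
    then obtain x y where x: "x \<in> carrier R" "x \<otimes> e = x" and y: "y \<in> carrier R" "y \<otimes> j = y"
      and z: "z = x \<oplus> y"
      unfolding cgenideal_idempotent[OF e] cgenideal_idempotent[OF j] set_add_def' by auto
    have "x \<otimes> j = x \<otimes> (e \<otimes> j)" using x e j by (metis m_assoc)
    moreover have "y \<otimes> e = y \<otimes> (e \<otimes> j)" using y e j by (metis m_assoc m_comm)
    ultimately have "z \<otimes> (e \<oplus> j) = z" using x y z ej e j by (simp add: l_distr r_distr)
    moreover have "z \<in> carrier R" using x y z by simp
    ultimately show "z \<in> PIdl (e \<oplus> j)"
      using e j unfolding cgenideal_def by force
  qed
qed

text \<open>
The sum is direct: the summands of \<open>x \<oplus> y\<close> are recovered by multiplying with \<open>e\<close> and with \<open>j\<close>.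
\<close>
lemma card_cgenideal_orthogonal_add:
  assumes e: "e \<in> carrier R" "e \<otimes> e = e" and j: "j \<in> carrier R" "j \<otimes> j = j"
    and ej: "e \<otimes> j = \<zero>"
  shows "card (PIdl (e \<oplus> j)) = card (PIdl e) * card (PIdl j)"
proof -
  have split: "(x \<oplus> y) \<otimes> e = x" "(x \<oplus> y) \<otimes> j = y"
    if xy: "x \<in> PIdl e" "y \<in> PIdl j" for x y
  proof -
    have x: "x \<in> carrier R" "x \<otimes> e = x" and y: "y \<in> carrier R" "y \<otimes> j = y"
      using xy cgenideal_idempotent[OF e] cgenideal_idempotent[OF j] by auto
    have "x \<otimes> j = x \<otimes> (e \<otimes> j)" using x e j by (metis m_assoc)
    moreover have "y \<otimes> e = y \<otimes> (e \<otimes> j)" using y e j by (metis m_assoc m_comm)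
    ultimately show "(x \<oplus> y) \<otimes> e = x" "(x \<oplus> y) \<otimes> j = y"
      using x y e j ej by (simp_all add: l_distr)
  qed
  have "inj_on (\<lambda>(x, y). x \<oplus> y) ((PIdl e) \<times> (PIdl j))"
  proof (rule inj_onI, clarify)
    fix x y x' y'
    assume "x \<in> PIdl e" "y \<in> PIdl j" "x' \<in> PIdl e" "y' \<in> PIdl j" "x \<oplus> y = x' \<oplus> y'"
    then show "x = x' \<and> y = y'" using split by metis
  qed
  moreover have "PIdl e <+>\<^bsub>R\<^esub> PIdl j = (\<lambda>(x, y). x \<oplus> y) ` ((PIdl e) \<times> (PIdl j))"
    unfolding set_add_def' by auto
  ultimately show ?thesis
    using assms by (simp add: cgenideal_orthogonal_add card_image card_cartesian_product)
qed

text \<open>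
An element fixed by both \<open>e \<oplus> j\<close> and \<open>f \<oplus> j\<close> is fixed by their product, which is \<open>j\<close>.
\<close>
lemma cgenideal_orthogonal_Int:
  assumes e: "e \<in> carrier R" and f: "f \<in> carrier R"
    and j: "j \<in> carrier R" "j \<otimes> j = j"
    and orth: "e \<otimes> f = \<zero>" "e \<otimes> j = \<zero>" "f \<otimes> j = \<zero>"
    and idem: "e \<otimes> e = e" "f \<otimes> f = f"
  shows "PIdl (e \<oplus> j) \<inter> PIdl (f \<oplus> j) = PIdl j"
proof -
  have *: "PIdl (e \<oplus> j) = {x \<in> carrier R. x \<otimes> (e \<oplus> j) = x}"
    "PIdl (f \<oplus> j) = {x \<in> carrier R. x \<otimes> (f \<oplus> j) = x}"
    "PIdl j = {x \<in> carrier R. x \<otimes> j = x}"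
    using assms by (intro cgenideal_idempotent orthogonal_idempotent_add a_closed; simp)+
  have prod: "(e \<oplus> j) \<otimes> (f \<oplus> j) = j"
    using assms m_comm[of f j] by (simp add: l_distr r_distr)
  show ?thesis
  proof (intro equalityI subsetI)
    fix x assume "x \<in> PIdl (e \<oplus> j) \<inter> PIdl (f \<oplus> j)"
    then have x: "x \<in> carrier R" "x \<otimes> (e \<oplus> j) = x" "x \<otimes> (f \<oplus> j) = x" using * by auto
    then have "x \<otimes> ((e \<oplus> j) \<otimes> (f \<oplus> j)) = x"
      using e f j by (subst m_assoc[symmetric]) auto
    then show "x \<in> PIdl j" using x prod * by simp
  next
    fix x assume "x \<in> PIdl j"
    then have x: "x \<in> carrier R" "x \<otimes> j = x" using * by auto
    have "x \<otimes> e = x \<otimes> (e \<otimes> j)" "x \<otimes> f = x \<otimes> (f \<otimes> j)" using x e f j by (metis m_assoc m_comm)+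
    then show "x \<in> PIdl (e \<oplus> j) \<inter> PIdl (f \<oplus> j)"
      using x e f j orth * by (simp add: r_distr)
  qed
qed

end

section \<open>Negation and quadratic residues\<close>

text \<open>
For \<open>p \<equiv> 3 (mod 4)\<close> the exponent \<open>(p - 1) / 2\<close> in Euler's criterion is odd, so that the Legendre
symbol changes sign together with its argument.
\<close>
lemma QuadRes_neg:
  assumes p: "prime p" "p mod 4 = 3" and i: "\<not> int p dvd i"
  shows "QuadRes (int p) (- i) \<longleftrightarrow> \<not> QuadRes (int p) i"
proof -
  have p2: "2 < p" using p prime_ge_2_nat[of p] by (cases "p = 2") auto
  have odd: "odd ((p - 1) div 2)" using p(2) by presburger
  have ni: "\<not> int p dvd - i" using i by simp
  have "[Legendre (- i) (int p) = - (i ^ ((p - 1) div 2))] (mod int p)"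
    using euler_criterion[OF p(1) p2, of "- i"] odd by simp
  moreover have "[- Legendre i (int p) = - (i ^ ((p - 1) div 2))] (mod int p)"
    using euler_criterion[OF p(1) p2, of i] by (simp add: cong_minus_minus_iff)
  ultimately have *: "[Legendre (- i) (int p) = - Legendre i (int p)] (mod int p)"
    by (metis cong_sym cong_trans)
  have L: "Legendre a (int p) = (if QuadRes (int p) a then 1 else - 1)" if "\<not> int p dvd a" for a
    using that by (simp add: Legendre_def cong_0_iff)
  have "\<not> [(1::int) = - 1] (mod int p)" "\<not> [(- 1 :: int) = 1] (mod int p)"
    using p2 by (auto simp: cong_iff_dvd_diff dest: zdvd_imp_le)
  then show ?thesis using * L[OF i] L[OF ni] by (auto split: if_splits)
qed

section \<open>Coefficient vectors as elements of the quotient ring\<close>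

text \<open>
The length \<open>p\<close> is arbitrary here; primality enters only with the quadratic residues.
\<close>
locale cyclic_quotient =
  fixes m p :: nat
  assumes m_pos: "0 < m" and p_gt_1: "1 < p"
begin

lemma Zmod_residues: "residues (2 ^ m)"
  using m_pos by unfold_locales (simp add: one_less_power)

sublocale Z: residues "2 ^ m" "Zmod m"
  unfolding Zmod_def by (rule Zmod_residues)

sublocale P: UP_cring "Zmod m" "Zpoly m"
  by (rule UP_cring.intro) (rule Z.cring)

abbreviation x_pow_p_minus_1 where
  "x_pow_p_minus_1 \<equiv> monom (Zpoly m) \<one>\<^bsub>Zmod m\<^esub> p \<ominus>\<^bsub>Zpoly m\<^esub> \<one>\<^bsub>Zpoly m\<^esub>"

sublocale I: ideal "cyclic_ideal m p" "Zpoly m"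
  unfolding cyclic_ideal_def by (rule P.P.cgenideal_ideal) simp

sublocale R: cring "Rp m p"
  unfolding Rp_def by (rule I.quotient_is_cring) (rule P.UP_cring)

sublocale cls: ring_hom_cring "Zpoly m" "Rp m p" "cls m p"
proof -
  have "cls m p = (+>\<^bsub>Zpoly m\<^esub>) (cyclic_ideal m p)"
    by (simp add: cls_def fun_eq_iff)
  then show "ring_hom_cring (Zpoly m) (Rp m p) (cls m p)"
    unfolding Rp_def using I.rcos_ring_hom_cring[OF P.UP_cring] by simp
qed

lemma Zmod_carrier: "carrier (Zmod m) = {0..<2 ^ m}"
  by (auto simp: Z.res_carrier_eq)

lemma mod_in_Zmod [simp]: "a mod 2 ^ m \<in> carrier (Zmod m)"
  by (simp add: Zmod_carrier)

lemma Zmod_mod_eq: "a \<in> carrier (Zmod m) \<Longrightarrow> a mod 2 ^ m = a"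
  by (simp add: Zmod_carrier)

lemma Zmod_finsum:
  "f \<in> A \<rightarrow> carrier (Zmod m) \<Longrightarrow> (\<Oplus>\<^bsub>Zmod m\<^esub>i\<in>A. f i) = (\<Sum>i\<in>A. f i) mod 2 ^ m"
  by (induct A rule: infinite_finite_induct)
     (auto simp: Z.res_zero_eq Z.res_add_eq mod_simps)

text \<open>
Coefficients are reduced here rather than in the argument: arbitrary integer functions may then be
fed in, all calculations take place in the integers, and equality in \<open>R\<^sub>p\<close> becomes congruence of
coefficients (\<open>of_vec_eq_iff\<close>).
\<close>
definition pol :: "(nat \<Rightarrow> int) \<Rightarrow> nat \<Rightarrow> int" where
  "pol f = (\<lambda>n. if n < p then f n mod 2 ^ m else 0)"

lemma pol_closed [simp]: "pol f \<in> carrier (Zpoly m)"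
proof -
  have "bound 0 p (pol f)" by (auto simp: pol_def)
  then show ?thesis
    by (auto simp: UP_def up_def pol_def Z.res_zero_eq)
       (simp add: Zmod_carrier)
qed

lemma coeff_pol [simp]: "coeff (Zpoly m) (pol f) n = (if n < p then f n mod 2 ^ m else 0)"
proof -
  have "pol f \<in> up (Zmod m)" using pol_closed[of f] by (simp add: UP_def)
  then show ?thesis by (simp add: UP_def) (simp add: pol_def)
qed

definition of_vec :: "(nat \<Rightarrow> int) \<Rightarrow> (nat \<Rightarrow> int) set" where
  "of_vec f = cls m p (pol f)"

lemma of_vec_closed [simp]: "of_vec f \<in> carrier (Rp m p)"
  by (simp add: of_vec_def)

lemma of_vec_cong: "(\<And>i. i < p \<Longrightarrow> [f i = g i] (mod 2 ^ m)) \<Longrightarrow> of_vec f = of_vec g"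
  unfolding of_vec_def pol_def cong_def by (metis (mono_tags))

lemma cls_eq_iff:
  "a \<in> carrier (Zpoly m) \<Longrightarrow> b \<in> carrier (Zpoly m) \<Longrightarrow>
     cls m p a = cls m p b \<longleftrightarrow> a \<ominus>\<^bsub>Zpoly m\<^esub> b \<in> cyclic_ideal m p"
  unfolding cls_def using P.P.quotient_eq_iff_same_a_r_cos[OF I.is_ideal] by auto

lemma coeff_mult_x_pow_p_minus_1:
  assumes q: "q \<in> carrier (Zpoly m)"
  shows "coeff (Zpoly m) (q \<otimes>\<^bsub>Zpoly m\<^esub> x_pow_p_minus_1) (n + p)
           = coeff (Zpoly m) q n \<ominus>\<^bsub>Zmod m\<^esub> coeff (Zpoly m) q (n + p)"
proof -
  have "q \<otimes>\<^bsub>Zpoly m\<^esub> x_pow_p_minus_1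
        = monom (Zpoly m) \<one>\<^bsub>Zmod m\<^esub> p \<otimes>\<^bsub>Zpoly m\<^esub> q \<ominus>\<^bsub>Zpoly m\<^esub> q"
    using q by (simp add: a_minus_def P.P.r_distr P.P.r_minus P.P.m_comm)
  then show ?thesis
    using q by (simp add: P.coeff_monom_mult del: P.coeff_mult)
qed

text \<open>
The coefficient of \<open>q (x\<^sup>p - 1)\<close> at \<open>n + p\<close> is \<open>q\<^sub>n - q\<^bsub>n+p\<^esub>\<close>. If the product has degree below \<open>p\<close>, the
coefficients of \<open>q\<close> are therefore periodic, and having finite support they vanish.
\<close>
lemma of_vec_inject:
  assumes "of_vec f = of_vec g" and i: "i < p"
  shows "[f i = g i] (mod 2 ^ m)"
proof -
  let ?d = "pol f \<ominus>\<^bsub>Zpoly m\<^esub> pol g"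
  have "?d \<in> cyclic_ideal m p"
    using assms(1) by (simp add: of_vec_def cls_eq_iff)
  then obtain q where q: "q \<in> carrier (Zpoly m)" "?d = q \<otimes>\<^bsub>Zpoly m\<^esub> x_pow_p_minus_1"
    unfolding cyclic_ideal_def cgenideal_def by blast
  have step: "coeff (Zpoly m) q (n + p) = coeff (Zpoly m) q n" for n
  proof -
    have "coeff (Zpoly m) ?d (n + p) = \<zero>\<^bsub>Zmod m\<^esub>"
      by (simp add: P.coeff_minus Z.res_zero_eq[symmetric])
    then have "coeff (Zpoly m) q n \<ominus>\<^bsub>Zmod m\<^esub> coeff (Zpoly m) q (n + p) = \<zero>\<^bsub>Zmod m\<^esub>"
      using q coeff_mult_x_pow_p_minus_1 by simp
    then show ?thesis
      using q(1) by (metis P.coeff_closed Z.r_right_minus_eq)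
  qed
  have periodic: "coeff (Zpoly m) q (n + N * p) = coeff (Zpoly m) q n" for n N
    by (induct N) (use step in \<open>simp_all add: add.assoc[symmetric] add.commute\<close>, metis add.assoc add.commute step)
  have "coeff (Zpoly m) q n = \<zero>\<^bsub>Zmod m\<^esub>" for n
  proof -
    let ?N = "Suc (deg (Zmod m) q)"
    have "?N * 1 \<le> ?N * p" using p_gt_1 by (intro mult_le_mono) auto
    then have "deg (Zmod m) q < n + ?N * p" by simp
    then have "coeff (Zpoly m) q (n + ?N * p) = \<zero>\<^bsub>Zmod m\<^esub>"
      using q(1) by (rule P.deg_aboveD)
    then show ?thesis using periodic by metis
  qed
  then have "q = \<zero>\<^bsub>Zpoly m\<^esub>"
    using q(1) by (intro P.up_eqI) auto
  then have "pol f = pol g" using q by simp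
  then have "pol f i = pol g i" by simp
  then show ?thesis using i by (simp add: pol_def cong_def)
qed

lemma of_vec_eq_iff: "of_vec f = of_vec g \<longleftrightarrow> (\<forall>i<p. [f i = g i] (mod 2 ^ m))"
  using of_vec_inject of_vec_cong by blast

lemma of_vec_add: "of_vec f \<oplus>\<^bsub>Rp m p\<^esub> of_vec g = of_vec (\<lambda>i. f i + g i)"
proof -
  have "pol f \<oplus>\<^bsub>Zpoly m\<^esub> pol g = pol (\<lambda>i. f i + g i)"
    by (rule P.up_eqI) (auto simp: Z.res_add_eq mod_simps)
  then show ?thesis by (simp add: of_vec_def flip: cls.hom_add)
qed

lemma of_vec_zero: "of_vec (\<lambda>_. 0) = \<zero>\<^bsub>Rp m p\<^esub>"
proof -
  have "pol (\<lambda>_. 0) = \<zero>\<^bsub>Zpoly m\<^esub>"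
    by (rule P.up_eqI) (auto simp: Z.res_zero_eq)
  then show ?thesis by (simp add: of_vec_def)
qed

lemma of_vec_finsum:
  "finite A \<Longrightarrow> (\<Oplus>\<^bsub>Rp m p\<^esub>j\<in>A. of_vec (f j)) = of_vec (\<lambda>i. \<Sum>j\<in>A. f j i)"
  by (induct A rule: finite_induct) (simp_all add: of_vec_zero of_vec_add)

lemma const_closed [simp]: "a \<in> carrier (Zmod m) \<Longrightarrow> const m p a \<in> carrier (Rp m p)"
  by (simp add: const_def)

lemma xpow_closed [simp]: "xpow m p i \<in> carrier (Rp m p)"
  by (simp add: xpow_def)

lemma const_mult_of_vec:
  assumes a: "a \<in> carrier (Zmod m)"
  shows "const m p a \<otimes>\<^bsub>Rp m p\<^esub> of_vec f = of_vec (\<lambda>i. a * f i)"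
proof -
  have "monom (Zpoly m) a 0 \<otimes>\<^bsub>Zpoly m\<^esub> pol f = pol (\<lambda>i. a * f i)"
    by (rule P.up_eqI) (use a in \<open>auto simp: P.monom_mult_is_smult Z.res_mult_eq mod_simps\<close>)
  then show ?thesis using a by (simp add: of_vec_def const_def flip: cls.hom_mult)
qed

lemma cls_monom_mult:
  assumes a: "a \<in> carrier (Zmod m)"
  shows "cls m p (monom (Zpoly m) a i) = const m p a \<otimes>\<^bsub>Rp m p\<^esub> xpow m p i"
  using a P.monom_mult[of a "\<one>\<^bsub>Zmod m\<^esub>" 0 i]
  by (simp add: const_def xpow_def flip: cls.hom_mult)

definition delta :: "nat \<Rightarrow> nat \<Rightarrow> int" where
  "delta j = (\<lambda>i. if i = j then 1 else 0)"

lemma one_eq_of_vec: "\<one>\<^bsub>Rp m p\<^esub> = of_vec (delta 0)"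
proof -
  have "\<one>\<^bsub>Zpoly m\<^esub> = pol (delta 0)"
    by (rule P.up_eqI) (use p_gt_1 m_pos in \<open>auto simp: Z.res_zero_eq Z.res_one_eq delta_def\<close>)
  then show ?thesis by (simp add: of_vec_def flip: cls.hom_one)
qed

lemma xpow_0: "xpow m p 0 = \<one>\<^bsub>Rp m p\<^esub>"
  by (simp add: xpow_def P.monom_one)

lemma xpow_Suc: "xpow m p (Suc j) = xpow m p j \<otimes>\<^bsub>Rp m p\<^esub> xpow m p 1"
  by (simp only: xpow_def P.monom_one_Suc) simp

text \<open>
The leading term of \<open>x f\<close> is wrapped around to the constant term by subtracting
\<open>f\<^bsub>p-1\<^esub> (x\<^sup>p - 1)\<close>.
\<close>
lemma xpow_1_mult_of_vec:
  "xpow m p 1 \<otimes>\<^bsub>Rp m p\<^esub> of_vec f = of_vec (\<lambda>i. f ((i + (p - 1)) mod p))"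
proof -
  let ?g = "\<lambda>i. f ((i + (p - 1)) mod p)"
  let ?c = "f (p - 1) mod 2 ^ m"
  let ?x = "monom (Zpoly m) \<one>\<^bsub>Zmod m\<^esub> 1"
  let ?q = "monom (Zpoly m) ?c 0"
  have 1: "coeff (Zpoly m) (?x \<otimes>\<^bsub>Zpoly m\<^esub> pol f) n
          = (case n of 0 \<Rightarrow> 0 | Suc k \<Rightarrow> if k < p then f k mod 2 ^ m else 0)" for n
  proof (cases n)
    case 0
    have "coeff (Zpoly m) (?x \<otimes>\<^bsub>Zpoly m\<^esub> pol f) 0 = \<zero>\<^bsub>Zmod m\<^esub>"
      by (subst P.coeff_mult) (simp_all del: coeff_pol)
    then show ?thesis using 0 by (simp add: Z.res_zero_eq)
  next
    case (Suc k)
    have "coeff (Zpoly m) (?x \<otimes>\<^bsub>Zpoly m\<^esub> pol f) (k + 1) = coeff (Zpoly m) (pol f) k"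
      by (subst P.coeff_monom_mult) (simp_all del: coeff_pol)
    then show ?thesis using Suc by (simp del: P.coeff_mult)
  qed
  have 2: "coeff (Zpoly m) (?q \<otimes>\<^bsub>Zpoly m\<^esub> x_pow_p_minus_1) n
       = (if n = p then ?c else if n = 0 then (- ?c) mod 2 ^ m else 0)" for n
  proof -
    have "coeff (Zpoly m) (?q \<otimes>\<^bsub>Zpoly m\<^esub> x_pow_p_minus_1) n
        = ?c \<otimes>\<^bsub>Zmod m\<^esub> coeff (Zpoly m) x_pow_p_minus_1 n"
      by (subst P.monom_mult_is_smult) simp_all
    moreover have "coeff (Zpoly m) x_pow_p_minus_1 n
        = (if n = p then \<one>\<^bsub>Zmod m\<^esub> else if n = 0 then \<ominus>\<^bsub>Zmod m\<^esub> \<one>\<^bsub>Zmod m\<^esub> else \<zero>\<^bsub>Zmod m\<^esub>)"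
      using p_gt_1 by (auto simp: a_minus_def)
    ultimately show ?thesis
      by (auto simp: Z.res_neg_eq Z.res_mult_eq Z.res_one_eq Z.res_zero_eq mod_simps simp del: P.coeff_mult)
  qed
  have shift: "(n + (p - 1)) mod p = n - 1" if "0 < n" "n < p" for n
    using that by (auto simp: mod_if)
  have "?x \<otimes>\<^bsub>Zpoly m\<^esub> pol f = pol ?g \<oplus>\<^bsub>Zpoly m\<^esub> ?q \<otimes>\<^bsub>Zpoly m\<^esub> x_pow_p_minus_1"
  proof (rule P.up_eqI)
    fix n
    show "coeff (Zpoly m) (?x \<otimes>\<^bsub>Zpoly m\<^esub> pol f) n
      = coeff (Zpoly m) (pol ?g \<oplus>\<^bsub>Zpoly m\<^esub> ?q \<otimes>\<^bsub>Zpoly m\<^esub> x_pow_p_minus_1) n"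
    proof (cases n)
      case 0
      then show ?thesis using p_gt_1
        by (subst 1, subst P.coeff_add, simp, simp, subst 2) (simp add: Z.res_add_eq mod_simps)
    next
      case (Suc k)
      then show ?thesis using p_gt_1 shift[of n]
        by (subst 1, subst P.coeff_add, simp, simp, subst 2) (auto simp: Z.res_add_eq mod_simps)
    qed
  qed simp_all
  moreover have "cls m p (?q \<otimes>\<^bsub>Zpoly m\<^esub> x_pow_p_minus_1) = \<zero>\<^bsub>Rp m p\<^esub>"
  proof -
    have "?q \<otimes>\<^bsub>Zpoly m\<^esub> x_pow_p_minus_1 \<ominus>\<^bsub>Zpoly m\<^esub> \<zero>\<^bsub>Zpoly m\<^esub> \<in> cyclic_ideal m p"
      unfolding cyclic_ideal_def cgenideal_def by (auto simp: a_minus_def)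
    then have "cls m p (?q \<otimes>\<^bsub>Zpoly m\<^esub> x_pow_p_minus_1) = cls m p \<zero>\<^bsub>Zpoly m\<^esub>"
      by (subst cls_eq_iff) auto
    then show ?thesis by simp
  qed
  ultimately have "cls m p (?x \<otimes>\<^bsub>Zpoly m\<^esub> pol f) = cls m p (pol ?g)"
    by (simp del: cls.hom_mult)
  then show ?thesis by (simp add: of_vec_def xpow_def)
qed

text \<open>
Modulo \<open>p\<close>, the index \<open>i + (p - 1) * j\<close> is \<open>i - j\<close>; this form stays within the natural numbers and
makes iterated shifts add up.
\<close>
lemma xpow_mult_of_vec:
  "xpow m p j \<otimes>\<^bsub>Rp m p\<^esub> of_vec f = of_vec (\<lambda>i. f ((i + (p - 1) * j) mod p))"
proof (induct j arbitrary: f)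
  case 0
  have "of_vec f = of_vec (\<lambda>i. f (i mod p))" by (rule of_vec_cong) simp
  then show ?case by (simp add: xpow_0)
next
  case (Suc j)
  have "xpow m p (Suc j) \<otimes>\<^bsub>Rp m p\<^esub> of_vec f
        = xpow m p j \<otimes>\<^bsub>Rp m p\<^esub> of_vec (\<lambda>i. f ((i + (p - 1)) mod p))"
    by (simp add: xpow_Suc R.m_assoc xpow_1_mult_of_vec del: One_nat_def)
  also have "\<dots> = of_vec (\<lambda>i. f ((i + (p - 1) * Suc j) mod p))"
    by (simp add: Suc mod_simps add_ac)
  finally show ?case .
qed

lemma mod_diff_add_cancel: "((i + (p - 1) * j) mod p + j) mod p = i mod p"
proof -
  have "i + (p - 1) * j + j = i + p * j"
    using p_gt_1 by (cases p) simp_all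
  then have "(i + (p - 1) * j + j) mod p = i mod p" by (metis mod_mult_self2)
  then show ?thesis by (simp only: mod_add_left_eq)
qed

lemma xpow_eq_of_vec:
  assumes j: "j < p"
  shows "xpow m p j = of_vec (delta j)"
proof -
  have "xpow m p j = xpow m p j \<otimes>\<^bsub>Rp m p\<^esub> of_vec (delta 0)"
    by (simp flip: one_eq_of_vec)
  also have "\<dots> = of_vec (\<lambda>i. delta 0 ((i + (p - 1) * j) mod p))"
    by (rule xpow_mult_of_vec)
  also have "\<dots> = of_vec (delta j)"
  proof (rule of_vec_cong)
    fix i assume i: "i < p"
    have "(i + (p - 1) * j) mod p = 0 \<longleftrightarrow> i = j"
    proof
      assume "(i + (p - 1) * j) mod p = 0"
      then show "i = j" using mod_diff_add_cancel[of i j] i j by simp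
    next
      assume "i = j"
      then have "i + (p - 1) * j = p * j" using p_gt_1 by (simp add: algebra_simps flip: mult_Suc)
      then show "(i + (p - 1) * j) mod p = 0" by simp
    qed
    then show "[delta 0 ((i + (p - 1) * j) mod p) = delta j i] (mod 2 ^ m)"
      by (simp add: delta_def)
  qed
  finally show ?thesis .
qed

lemma of_vec_expand: "of_vec f = (\<Oplus>\<^bsub>Rp m p\<^esub>j\<in>{..<p}. const m p (f j mod 2 ^ m) \<otimes>\<^bsub>Rp m p\<^esub> xpow m p j)"
proof -
  have "(\<Oplus>\<^bsub>Rp m p\<^esub>j\<in>{..<p}. const m p (f j mod 2 ^ m) \<otimes>\<^bsub>Rp m p\<^esub> xpow m p j)
      = (\<Oplus>\<^bsub>Rp m p\<^esub>j\<in>{..<p}. of_vec (\<lambda>i. (f j mod 2 ^ m) * delta j i))"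
    by (rule R.finsum_cong') (auto simp: xpow_eq_of_vec const_mult_of_vec)
  also have "\<dots> = of_vec (\<lambda>i. \<Sum>j<p. (f j mod 2 ^ m) * delta j i)"
    by (simp add: of_vec_finsum)
  also have "\<dots> = of_vec f"
    by (rule of_vec_cong) (simp add: delta_def if_distrib[of "(*) _"] sum.delta cong: if_cong)
  finally show ?thesis ..
qed

definition conv :: "(nat \<Rightarrow> int) \<Rightarrow> (nat \<Rightarrow> int) \<Rightarrow> nat \<Rightarrow> int" where
  "conv f g i = (\<Sum>j<p. f j * g ((i + (p - 1) * j) mod p))"

text \<open>
Expanding \<open>f\<close> into monomials turns the product into a combination of cyclic shifts of \<open>g\<close>.
\<close>
lemma of_vec_mult: "of_vec f \<otimes>\<^bsub>Rp m p\<^esub> of_vec g = of_vec (conv f g)"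
proof -
  have "of_vec f \<otimes>\<^bsub>Rp m p\<^esub> of_vec g
     = (\<Oplus>\<^bsub>Rp m p\<^esub>j\<in>{..<p}. const m p (f j mod 2 ^ m) \<otimes>\<^bsub>Rp m p\<^esub> xpow m p j \<otimes>\<^bsub>Rp m p\<^esub> of_vec g)"
    by (subst of_vec_expand[of f], rule R.finsum_ldistr) auto
  also have "\<dots> = (\<Oplus>\<^bsub>Rp m p\<^esub>j\<in>{..<p}. of_vec (\<lambda>i. (f j mod 2 ^ m) * g ((i + (p - 1) * j) mod p)))"
    by (rule R.finsum_cong') (auto simp: R.m_assoc xpow_mult_of_vec const_mult_of_vec)
  also have "\<dots> = of_vec (\<lambda>i. \<Sum>j<p. (f j mod 2 ^ m) * g ((i + (p - 1) * j) mod p))"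
    by (simp add: of_vec_finsum)
  also have "\<dots> = of_vec (conv f g)"
    unfolding conv_def by (intro of_vec_cong cong_sum cong_mult) (auto simp: cong_def)
  finally show ?thesis .
qed

text \<open>
A polynomial of any degree is a sum of monomials, and each monomial is a shift of the unit vector.
\<close>
lemma of_vec_surj: "x \<in> carrier (Rp m p) \<Longrightarrow> \<exists>f. x = of_vec f"
proof -
  assume "x \<in> carrier (Rp m p)"
  then obtain q where q: "q \<in> carrier (Zpoly m)" "x = cls m p q"
    unfolding Rp_def FactRing_simps cls_def by auto
  let ?c = "coeff (Zpoly m) q"
  let ?g = "\<lambda>j i. ?c j * delta 0 ((i + (p - 1) * j) mod p)"
  have c: "?c j \<in> carrier (Zmod m)" for j using q by simp
  have mon: "cls m p (monom (Zpoly m) (?c j) j) = of_vec (?g j)" for j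
  proof -
    have "cls m p (monom (Zpoly m) (?c j) j)
        = const m p (?c j) \<otimes>\<^bsub>Rp m p\<^esub> (xpow m p j \<otimes>\<^bsub>Rp m p\<^esub> of_vec (delta 0))"
      using c by (simp add: cls_monom_mult flip: one_eq_of_vec)
    then show ?thesis using c by (simp only: xpow_mult_of_vec const_mult_of_vec)
  qed
  have "x = cls m p (\<Oplus>\<^bsub>Zpoly m\<^esub>j\<in>{..deg (Zmod m) q}. monom (Zpoly m) (?c j) j)"
    using q by (simp only: P.up_repr)
  also have "\<dots> = (\<Oplus>\<^bsub>Rp m p\<^esub>j\<in>{..deg (Zmod m) q}. of_vec (?g j))"
    using c by (subst cls.hom_finsum) (auto simp: comp_def mon)
  also have "\<dots> = of_vec (\<lambda>i. \<Sum>j\<le>deg (Zmod m) q. ?g j i)"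
    by (simp add: of_vec_finsum)
  finally show ?thesis by blast
qed

lemma vec_class_eq_of_vec:
  assumes "v \<in> vectors m p"
  shows "vec_class m p v = of_vec v"
proof -
  have v: "v j \<in> carrier (Zmod m)" if "j < p" for j
    using assms that by (auto simp: vectors_def)
  have "vec_class m p v = (\<Oplus>\<^bsub>Rp m p\<^esub>j\<in>{..<p}. cls m p (monom (Zpoly m) (v j) j))"
    unfolding vec_class_def by (subst cls.hom_finsum) (auto simp: comp_def v)
  also have "\<dots> = of_vec v"
    unfolding of_vec_expand by (rule R.finsum_cong') (auto simp: v Zmod_mod_eq cls_monom_mult)
  finally show ?thesis .
qed

lemma bij_betw_vec_class: "bij_betw (vec_class m p) (vectors m p) (carrier (Rp m p))"
proof (rule bij_betwI')
  fix v w assume vw: "v \<in> vectors m p" "w \<in> vectors m p"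
  show "vec_class m p v = vec_class m p w \<longleftrightarrow> v = w"
  proof
    assume "vec_class m p v = vec_class m p w"
    then have "\<forall>i<p. v i mod 2 ^ m = w i mod 2 ^ m"
      using vw by (simp add: vec_class_eq_of_vec of_vec_eq_iff cong_def)
    moreover have "\<forall>i<p. v i \<in> carrier (Zmod m) \<and> w i \<in> carrier (Zmod m)"
      using vw by (auto simp: vectors_def)
    ultimately have "\<forall>i<p. v i = w i" by (simp add: Zmod_mod_eq)
    then show "v = w"
      using vw unfolding vectors_def by (auto intro: PiE_ext)
  qed simp
next
  fix x assume "x \<in> carrier (Rp m p)"
  then obtain f where f: "x = of_vec f" using of_vec_surj by blast
  let ?v = "\<lambda>i\<in>{..<p}. f i mod 2 ^ m"
  have "?v \<in> vectors m p" by (auto simp: vectors_def)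
  moreover have "of_vec ?v = of_vec f" by (rule of_vec_cong) (simp add: cong_def)
  ultimately show "\<exists>v\<in>vectors m p. x = vec_class m p v"
    using f by (metis vec_class_eq_of_vec)
qed (simp add: vec_class_eq_of_vec)

lemma card_Rp: "card (carrier (Rp m p)) = 2 ^ (m * p)"
proof -
  have "card (carrier (Rp m p)) = card (vectors m p)"
    using bij_betw_vec_class by (simp add: bij_betw_same_card)
  also have "\<dots> = 2 ^ (m * p)"
    by (simp add: vectors_def card_PiE Zmod_carrier power_mult nat_power_eq)
  finally show ?thesis .
qed

section \<open>Reversal of coordinates and duality\<close>

lemma p_minus_1_involution: "((p - 1) * ((p - 1) * j)) mod p = j mod p"
proof -
  obtain q where q: "p = Suc q" using p_gt_1 by (cases p) auto
  have "q * (q * j) + p * j = j + p * (q * j)" unfolding q by (simp add: algebra_simps)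
  then have "(q * (q * j)) mod p = j mod p" by (metis mod_mult_self2)
  then show ?thesis using q by simp
qed

text \<open>
The coordinate permutation \<open>i \<mapsto> -i (mod p)\<close>, extended by the identity as \<open>permutes\<close> demands.
On \<open>R\<^sub>p\<close> it induces the automorphism \<open>x \<mapsto> x\<^sup>-\<^sup>1\<close>.
\<close>
definition neg :: "nat \<Rightarrow> nat" where
  "neg i = (if i < p then ((p - 1) * i) mod p else i)"

lemma neg_less: "i < p \<Longrightarrow> neg i < p"
  by (simp add: neg_def)

lemma neg_neg: "neg (neg i) = i"
  using p_gt_1 p_minus_1_involution[of i] by (simp add: neg_def mod_mult_right_eq)

lemma neg_permutes: "neg permutes {..<p}"
proof (rule bij_imp_permutes)
  show "bij_betw neg {..<p} {..<p}"
    by (rule bij_betwI[of _ _ _ neg]) (auto simp: neg_less neg_neg)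
qed (simp add: neg_def)

lemma neg_bij: "bij_betw neg {..<p} {..<p}"
  using neg_permutes by (rule permutes_imp_bij)

lemma neg_index: "i < p \<Longrightarrow> j < p \<Longrightarrow> neg ((i + (p - 1) * j) mod p) = (neg i + j) mod p"
proof -
  assume "i < p" "j < p"
  then have "neg ((i + (p - 1) * j) mod p) = ((p - 1) * i + (p - 1) * ((p - 1) * j)) mod p"
    by (simp add: neg_def mod_mult_right_eq distrib_left)
  also have "\<dots> = ((p - 1) * i + (p - 1) * ((p - 1) * j) mod p) mod p"
    by (simp only: mod_simps)
  also have "\<dots> = (neg i + j) mod p"
    using \<open>i < p\<close> by (simp only: p_minus_1_involution) (simp add: neg_def mod_simps)
  finally show ?thesis .
qed

text \<open>
Negation modulo \<open>p\<close> is additive and permutes the summation range; hence reversal is multiplicative on \<open>R\<^sub>p\<close>.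
\<close>
lemma conv_neg:
  assumes i: "i < p"
  shows "conv (f \<circ> neg) (g \<circ> neg) i = conv f g (neg i)"
proof -
  have "conv (f \<circ> neg) (g \<circ> neg) i
     = (\<Sum>j<p. f (neg j) * g ((neg i + (p - 1) * neg j) mod p))"
    unfolding conv_def
  proof (rule sum.cong)
    fix j assume j: "j \<in> {..<p}"
    have "neg ((i + (p - 1) * j) mod p) = (neg i + (p - 1) * neg j) mod p"
      using neg_index[of i j] i j p_minus_1_involution[of j] by (simp add: neg_def mod_simps)
         (metis mod_add_right_eq mod_mult_right_eq p_minus_1_involution)
    then show "(f \<circ> neg) j * (g \<circ> neg) ((i + (p - 1) * j) mod p)
        = f (neg j) * g ((neg i + (p - 1) * neg j) mod p)" by simp
  qed simp
  also have "\<dots> = conv f g (neg i)"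
    unfolding conv_def by (rule sum.reindex_bij_betw[OF neg_bij])
  finally show ?thesis .
qed

lemma of_vec_neg_cong: "of_vec f = of_vec g \<Longrightarrow> of_vec (f \<circ> neg) = of_vec (g \<circ> neg)"
  by (simp add: of_vec_eq_iff neg_less)

lemma of_vec_neg_mult: "of_vec (f \<circ> neg) \<otimes>\<^bsub>Rp m p\<^esub> of_vec (g \<circ> neg) = of_vec (conv f g \<circ> neg)"
  unfolding of_vec_mult by (rule of_vec_cong) (simp add: conv_neg)

lemma of_vec_neg_neg: "of_vec ((f \<circ> neg) \<circ> neg) = of_vec f"
  by (rule of_vec_cong) (simp add: neg_neg)

lemma mem_codewords: "v \<in> codewords m p C \<longleftrightarrow> v \<in> vectors m p \<and> of_vec v \<in> C"
  unfolding codewords_def by (auto simp: vec_class_eq_of_vec)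

lemma card_codewords: "C \<subseteq> carrier (Rp m p) \<Longrightarrow> card (codewords m p C) = card C"
proof -
  assume C: "C \<subseteq> carrier (Rp m p)"
  have "bij_betw (vec_class m p) (codewords m p C) C"
  proof (rule bij_betw_subset[OF bij_betw_vec_class])
    have "C \<subseteq> vec_class m p ` vectors m p"
      using C bij_betw_vec_class by (simp add: bij_betw_def)
    then show "vec_class m p ` codewords m p C = C"
      unfolding codewords_def by auto
  qed (auto simp: codewords_def)
  then show ?thesis by (rule bij_betw_same_card)
qed

lemma vector_neg: "v \<in> vectors m p \<Longrightarrow> v \<circ> neg \<in> vectors m p"
  by (auto simp: vectors_def neg_less PiE_iff extensional_def) (simp add: neg_def)

lemma codewords_neg_aux:
  assumes "v \<in> codewords m p (PIdl\<^bsub>Rp m p\<^esub> (of_vec a))"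
  shows "v \<circ> neg \<in> codewords m p (PIdl\<^bsub>Rp m p\<^esub> (of_vec (a \<circ> neg)))"
proof -
  from assms have v: "v \<in> vectors m p" "of_vec v \<in> PIdl\<^bsub>Rp m p\<^esub> (of_vec a)"
    by (auto simp: mem_codewords)
  then obtain b where "of_vec v = of_vec b \<otimes>\<^bsub>Rp m p\<^esub> of_vec a"
    unfolding cgenideal_def using of_vec_surj by blast
  then have "of_vec v = of_vec (conv b a)" by (simp add: of_vec_mult)
  then have "of_vec (v \<circ> neg) = of_vec (b \<circ> neg) \<otimes>\<^bsub>Rp m p\<^esub> of_vec (a \<circ> neg)"
    unfolding of_vec_neg_mult by (rule of_vec_neg_cong)
  then show ?thesis
    using v vector_neg by (auto simp: mem_codewords cgenideal_def)
qed

lemma codewords_neg: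
  "codewords m p (PIdl\<^bsub>Rp m p\<^esub> (of_vec (a \<circ> neg)))
     = (\<lambda>v. v \<circ> neg) ` codewords m p (PIdl\<^bsub>Rp m p\<^esub> (of_vec a))"
proof (intro equalityI subsetI)
  fix v assume v: "v \<in> codewords m p (PIdl\<^bsub>Rp m p\<^esub> (of_vec (a \<circ> neg)))"
  have "v \<circ> neg \<in> codewords m p (PIdl\<^bsub>Rp m p\<^esub> (of_vec a))"
    using codewords_neg_aux[OF v] by (simp only: of_vec_neg_neg)
  moreover have "v = (v \<circ> neg) \<circ> neg" by (simp add: fun_eq_iff neg_neg)
  ultimately show "v \<in> (\<lambda>v. v \<circ> neg) ` codewords m p (PIdl\<^bsub>Rp m p\<^esub> (of_vec a))" by blast
qed (auto intro: codewords_neg_aux)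

lemma equivalent_codes_neg:
  "equivalent_codes p (codewords m p (PIdl\<^bsub>Rp m p\<^esub> (of_vec a)))
     (codewords m p (PIdl\<^bsub>Rp m p\<^esub> (of_vec (a \<circ> neg))))"
  unfolding equivalent_codes_def by (rule exI[of _ neg]) (simp add: neg_permutes codewords_neg)

lemma PIdl_subset: "a \<in> carrier (Rp m p) \<Longrightarrow> PIdl\<^bsub>Rp m p\<^esub> a \<subseteq> carrier (Rp m p)"
  by (auto simp: cgenideal_def)

lemma card_PIdl_neg: "card (PIdl\<^bsub>Rp m p\<^esub> (of_vec (a \<circ> neg))) = card (PIdl\<^bsub>Rp m p\<^esub> (of_vec a))"
proof -
  have "inj (\<lambda>v :: nat \<Rightarrow> int. v \<circ> neg)"
  proof (rule injI)
    fix v w :: "nat \<Rightarrow> int" assume "v \<circ> neg = w \<circ> neg"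
    then have "(v \<circ> neg) (neg i) = (w \<circ> neg) (neg i)" for i by simp
    then show "v = w" by (simp add: fun_eq_iff neg_neg)
  qed
  then have "card (codewords m p (PIdl\<^bsub>Rp m p\<^esub> (of_vec (a \<circ> neg)))) = card (codewords m p (PIdl\<^bsub>Rp m p\<^esub> (of_vec a)))"
    unfolding codewords_neg by (intro card_image) (erule inj_on_subset, simp)
  then show ?thesis by (simp add: card_codewords PIdl_subset)
qed

text \<open>
The inner product of \<open>u\<close> and \<open>v\<close> is the constant coefficient of \<open>u(x) v(x\<^sup>-\<^sup>1)\<close>.
\<close>
lemma inner_prod_eq_conv:
  assumes "u \<in> vectors m p" "v \<in> vectors m p"
  shows "inner_prod m p u v = conv u (v \<circ> neg) 0 mod 2 ^ m"
proof -
  have "inner_prod m p u v = (\<Sum>i<p. (u i * v i) mod 2 ^ m) mod 2 ^ m"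
    unfolding inner_prod_def Z.res_mult_eq by (rule Zmod_finsum) simp
  also have "\<dots> = (\<Sum>i<p. u i * v i) mod 2 ^ m" by (rule mod_sum_eq)
  also have "(\<Sum>i<p. u i * v i) = conv u (v \<circ> neg) 0"
    unfolding conv_def
  proof (rule sum.cong)
    fix i assume i: "i \<in> {..<p}"
    then have "neg ((0 + (p - 1) * i) mod p) = i"
      using neg_index[of 0 i] p_gt_1 by (simp add: neg_def)
    then show "u i * v i = u i * (v \<circ> neg) ((0 + (p - 1) * i) mod p)" by simp
  qed simp
  finally show ?thesis .
qed

text \<open>
All coefficients of \<open>u(x) a(x\<^sup>-\<^sup>1)\<close>, not only the constant one, are inner products of \<open>u\<close> with code words,
because the ideal contains all cyclic shifts of \<open>a\<close>. So the dual of a principal ideal is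
the annihilator of the reversed generator.
\<close>
lemma dual_code_PIdl:
  "dual_code m p (codewords m p (PIdl\<^bsub>Rp m p\<^esub> (of_vec a)))
     = {u \<in> vectors m p. of_vec u \<otimes>\<^bsub>Rp m p\<^esub> of_vec (a \<circ> neg) = \<zero>\<^bsub>Rp m p\<^esub>}"
proof (intro equalityI subsetI)
  fix u assume "u \<in> {u \<in> vectors m p. of_vec u \<otimes>\<^bsub>Rp m p\<^esub> of_vec (a \<circ> neg) = \<zero>\<^bsub>Rp m p\<^esub>}"
  then have u: "u \<in> vectors m p" "of_vec u \<otimes>\<^bsub>Rp m p\<^esub> of_vec (a \<circ> neg) = \<zero>\<^bsub>Rp m p\<^esub>" by auto
  have "inner_prod m p u v = 0" if v: "v \<in> codewords m p (PIdl\<^bsub>Rp m p\<^esub> (of_vec a))" for v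
  proof -
    have "of_vec (v \<circ> neg) \<in> PIdl\<^bsub>Rp m p\<^esub> (of_vec (a \<circ> neg))"
      using codewords_neg_aux[OF v] by (simp add: mem_codewords)
    then obtain x where "x \<in> carrier (Rp m p)" "of_vec (v \<circ> neg) = x \<otimes>\<^bsub>Rp m p\<^esub> of_vec (a \<circ> neg)"
      unfolding cgenideal_def by blast
    then have "of_vec u \<otimes>\<^bsub>Rp m p\<^esub> of_vec (v \<circ> neg) = x \<otimes>\<^bsub>Rp m p\<^esub> (of_vec u \<otimes>\<^bsub>Rp m p\<^esub> of_vec (a \<circ> neg))"
      by (simp add: R.m_lcomm)
    then have "of_vec (conv u (v \<circ> neg)) = of_vec (\<lambda>_. 0)"
      using u \<open>x \<in> _\<close> by (simp add: of_vec_mult of_vec_zero)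
    then have "[conv u (v \<circ> neg) 0 = 0] (mod 2 ^ m)"
      using p_gt_1 by (auto simp: of_vec_eq_iff)
    then show ?thesis
      using u v by (simp add: inner_prod_eq_conv mem_codewords cong_def)
  qed
  then show "u \<in> dual_code m p (codewords m p (PIdl\<^bsub>Rp m p\<^esub> (of_vec a)))"
    using u by (simp add: dual_code_def Z.res_zero_eq)
next
  fix u assume u: "u \<in> dual_code m p (codewords m p (PIdl\<^bsub>Rp m p\<^esub> (of_vec a)))"
  then have uv: "u \<in> vectors m p" by (simp add: dual_code_def)
  have "[conv u (a \<circ> neg) k = 0] (mod 2 ^ m)" if k: "k < p" for k
  proof -
    let ?s = "\<lambda>i. a ((i + (p - 1) * k) mod p)"
    let ?v = "\<lambda>i\<in>{..<p}. ?s i mod 2 ^ m"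
    have v: "?v \<in> vectors m p" by (auto simp: vectors_def)
    have "of_vec ?v = of_vec ?s" by (rule of_vec_cong) (simp add: cong_def)
    also have "\<dots> = xpow m p k \<otimes>\<^bsub>Rp m p\<^esub> of_vec a" by (rule xpow_mult_of_vec[symmetric])
    finally have "?v \<in> codewords m p (PIdl\<^bsub>Rp m p\<^esub> (of_vec a))"
      using v by (auto simp: mem_codewords cgenideal_def)
    then have "inner_prod m p u ?v = 0"
      using u by (simp add: dual_code_def Z.res_zero_eq)
    then have "[conv u (?v \<circ> neg) 0 = 0] (mod 2 ^ m)"
      using uv v by (simp add: inner_prod_eq_conv cong_def)
    moreover have "[conv u (?v \<circ> neg) 0 = conv u (a \<circ> neg) k] (mod 2 ^ m)"
      unfolding conv_def
    proof (rule cong_sum)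
      fix j assume j: "j \<in> {..<p}"
      have "neg ((0 + (p - 1) * j) mod p) = j"
        using neg_index[of 0 j] j p_gt_1 by (simp add: neg_def)
      moreover have "neg ((k + (p - 1) * j) mod p) = (j + (p - 1) * k) mod p"
        using neg_index[of k j] j k by (simp add: neg_def mod_simps add.commute)
      ultimately have "[(?v \<circ> neg) ((0 + (p - 1) * j) mod p) = (a \<circ> neg) ((k + (p - 1) * j) mod p)] (mod 2 ^ m)"
        using j by (simp add: cong_def)
      then show "[u j * (?v \<circ> neg) ((0 + (p - 1) * j) mod p)
          = u j * (a \<circ> neg) ((k + (p - 1) * j) mod p)] (mod 2 ^ m)"
        by (rule cong_scalar_left)
    qed
    ultimately show ?thesis by (metis cong_sym cong_trans)
  qed
  then have "of_vec u \<otimes>\<^bsub>Rp m p\<^esub> of_vec (a \<circ> neg) = \<zero>\<^bsub>Rp m p\<^esub>"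
    unfolding of_vec_mult of_vec_zero[symmetric] by (intro of_vec_cong) auto
  then show "u \<in> {u \<in> vectors m p. of_vec u \<otimes>\<^bsub>Rp m p\<^esub> of_vec (a \<circ> neg) = \<zero>\<^bsub>Rp m p\<^esub>}"
    using uv by simp
qed

lemma conv_constant: "conv f (\<lambda>_. c) = (\<lambda>_. (\<Sum>j<p. f j) * c)"
  by (simp add: conv_def sum_distrib_right fun_eq_iff)

text \<open>
Multiplying a constant vector by \<open>b\<close> scales it by the coefficient sum of \<open>b\<close>; as \<open>c\<close> is
invertible, exactly the constant vectors arise.
\<close>
lemma card_PIdl_constant:
  assumes c: "coprime c (2 ^ m)"
  shows "card (PIdl\<^bsub>Rp m p\<^esub> (of_vec (\<lambda>_. c))) = 2 ^ m"
proof -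
  let ?f = "\<lambda>a. of_vec (\<lambda>_. a)"
  have "PIdl\<^bsub>Rp m p\<^esub> (of_vec (\<lambda>_. c)) = ?f ` {0..<2 ^ m}"
  proof (intro equalityI subsetI)
    fix x assume "x \<in> PIdl\<^bsub>Rp m p\<^esub> (of_vec (\<lambda>_. c))"
    then obtain b where "x = of_vec b \<otimes>\<^bsub>Rp m p\<^esub> of_vec (\<lambda>_. c)"
      unfolding cgenideal_def using of_vec_surj by blast
    then have "x = ?f ((\<Sum>j<p. b j) * c)" by (simp add: of_vec_mult conv_constant)
    also have "\<dots> = ?f (((\<Sum>j<p. b j) * c) mod 2 ^ m)" by (rule of_vec_cong) (simp add: cong_def)
    finally show "x \<in> ?f ` {0..<2 ^ m}" by auto
  next
    fix x assume "x \<in> ?f ` {0..<2 ^ m}"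
    then obtain a where x: "x = ?f a" by blast
    obtain d where d: "[c * d = 1] (mod 2 ^ m)"
      using c cong_solve_coprime_int by blast
    have "x = of_vec (\<lambda>i. a * d * delta 0 i) \<otimes>\<^bsub>Rp m p\<^esub> of_vec (\<lambda>_. c)"
      unfolding x of_vec_mult conv_constant
    proof (rule of_vec_cong)
      have "(\<Sum>j<p. a * d * delta 0 j) = a * d"
        using p_gt_1 by (simp add: delta_def if_distrib[of "(*) _"] sum.delta' sum.delta cong: if_cong)
      moreover have "[a * (c * d) = a * 1] (mod 2 ^ m)" using d by (rule cong_scalar_left)
      ultimately show "[a = (\<Sum>j<p. a * d * delta 0 j) * c] (mod 2 ^ m)"
        by (simp add: cong_sym mult_ac)
    qed
    then show "x \<in> PIdl\<^bsub>Rp m p\<^esub> (of_vec (\<lambda>_. c))" by (auto simp: cgenideal_def)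
  qed
  moreover have "inj_on ?f {0..<2 ^ m}"
    using p_gt_1 by (auto simp: inj_on_def of_vec_eq_iff cong_def)
  ultimately show ?thesis by (simp add: card_image nat_power_eq)
qed

section \<open>The quadratic residue idempotents\<close>

definition qr_vec :: "int \<Rightarrow> int \<Rightarrow> int \<Rightarrow> nat \<Rightarrow> int" where
  "qr_vec a b c i = (if i = 0 then a else if i \<in> quad_res p then b else c)"

lemma finsum_xpow: "A \<subseteq> {..<p} \<Longrightarrow> (\<Oplus>\<^bsub>Rp m p\<^esub>i\<in>A. xpow m p i) = of_vec (\<lambda>i. if i \<in> A then 1 else 0)"
proof -
  assume A: "A \<subseteq> {..<p}"
  then have fin: "finite A" using finite_subset by blast
  have "(\<Oplus>\<^bsub>Rp m p\<^esub>i\<in>A. xpow m p i) = (\<Oplus>\<^bsub>Rp m p\<^esub>i\<in>A. of_vec (delta i))"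
    using A by (intro R.finsum_cong') (auto simp: xpow_eq_of_vec)
  also have "\<dots> = of_vec (\<lambda>i. if i \<in> A then 1 else 0)"
    using fin by (simp add: of_vec_finsum delta_def)
  finally show ?thesis .
qed

lemma e1_eq_of_vec: "e1 m p = of_vec (\<lambda>i. if i \<in> quad_res p then 1 else 0)"
  unfolding e1_def by (rule finsum_xpow) (auto simp: quad_res_def)

lemma e2_eq_of_vec: "e2 m p = of_vec (\<lambda>i. if i \<in> quad_nonres p then 1 else 0)"
  unfolding e2_def by (rule finsum_xpow) (auto simp: quad_nonres_def)

lemma allone_eq_of_vec: "allone m p = of_vec (\<lambda>_. 1)"
  unfolding allone_def e1_eq_of_vec e2_eq_of_vec one_eq_of_vec of_vec_add
  by (rule of_vec_cong) (auto simp: delta_def quad_res_def quad_nonres_def)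

lemma const_eq_of_vec: "a \<in> carrier (Zmod m) \<Longrightarrow> const m p a = of_vec (\<lambda>i. a * delta 0 i)"
  using const_mult_of_vec[of a "delta 0"] by (simp flip: one_eq_of_vec)

lemma comb_eq_of_vec:
  assumes "a \<in> carrier (Zmod m)" "b \<in> carrier (Zmod m)" "c \<in> carrier (Zmod m)"
  shows "comb m p a b c = of_vec (qr_vec a b c)"
  unfolding comb_def e1_eq_of_vec e2_eq_of_vec const_mult_of_vec[OF assms(2)] const_mult_of_vec[OF assms(3)]
    const_eq_of_vec[OF assms(1)] of_vec_add
  by (rule of_vec_cong) (auto simp: delta_def quad_res_def quad_nonres_def qr_vec_def)

lemma quad_res_neg:
  assumes p: "prime p" "p mod 4 = 3" and i: "0 < i" "i < p"
  shows "neg i \<in> quad_res p \<longleftrightarrow> i \<notin> quad_res p"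
proof -
  have ndvd: "\<not> int p dvd int i" using i by (simp add: nat_dvd_not_less)
  have cong: "[int (neg i) = - int i] (mod int p)"
  proof -
    have "int ((p - 1) * i) = - int i + int p * int i"
      using p_gt_1 by (simp add: of_nat_diff algebra_simps)
    then have "int (neg i) = (- int i + int p * int i) mod int p"
      using i by (simp add: neg_def zmod_int)
    then show ?thesis by (metis cong_def mod_mod_trivial mod_mult_self2)
  qed
  have "neg i \<noteq> 0"
  proof
    assume "neg i = 0"
    then have "[- int i = 0] (mod int p)" using cong_sym[OF cong] by simp
    then have "int p dvd - int i" by (simp only: cong_0_iff)
    then show False using ndvd by simp
  qed
  then have "neg i \<in> quad_res p \<longleftrightarrow> QuadRes (int p) (int (neg i))"
    using neg_less[OF i(2)] by (simp add: quad_res_def)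
  also have "\<dots> \<longleftrightarrow> QuadRes (int p) (- int i)"
    using cong unfolding QuadRes_def by (meson cong_trans cong_sym)
  also have "\<dots> \<longleftrightarrow> \<not> QuadRes (int p) (int i)" using p ndvd by (rule QuadRes_neg)
  also have "\<dots> \<longleftrightarrow> i \<notin> quad_res p" using i by (simp add: quad_res_def)
  finally show ?thesis .
qed

lemma neg_0: "neg 0 = 0" using p_gt_1 by (simp add: neg_def)

lemma of_vec_qr_neg:
  assumes "prime p" "p mod 4 = 3"
  shows "of_vec (qr_vec a b c \<circ> neg) = of_vec (qr_vec a c b)"
proof (rule of_vec_cong)
  fix i assume i: "i < p"
  show "[(qr_vec a b c \<circ> neg) i = qr_vec a c b i] (mod 2 ^ m)"
  proof (cases "i = 0")
    case True
    then show ?thesis by (simp add: neg_0 qr_vec_def)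
  next
    case False
    have "neg i \<noteq> 0" using False neg_neg[of i] neg_0 by metis
    then show ?thesis using False i quad_res_neg[OF assms, of i] by (simp add: qr_vec_def)
  qed
qed

text \<open>
Reversal exchanges \<open>b\<close> and \<open>c\<close>, so the coefficient sum agrees with that of \<open>qr_vec a c b\<close>. Adding
the two makes the entries independent of residuosity; the factor 2, which is not invertible
modulo \<open>2\<^sup>m\<close>, is what remains of this averaging.
\<close>
lemma sum_qr_vec:
  assumes "prime p" "p mod 4 = 3"
  shows "2 * (\<Sum>i<p. qr_vec a b c i) = 2 * a + (b + c) * (int p - 1)"
proof -
  have "(\<Sum>i<p. qr_vec a b c i) = (\<Sum>i<p. qr_vec a b c (neg i))"
    by (rule sum.reindex_bij_betw[OF neg_bij, symmetric])
  also have "\<dots> = (\<Sum>i<p. qr_vec a c b i)"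
  proof (rule sum.cong)
    fix i assume i: "i \<in> {..<p}"
    show "qr_vec a b c (neg i) = qr_vec a c b i"
    proof (cases "i = 0")
      case False
      have "neg i \<noteq> 0" using False neg_neg[of i] neg_0 by metis
      then show ?thesis using False i quad_res_neg[OF assms, of i] by (simp add: qr_vec_def)
    qed (simp add: neg_0 qr_vec_def)
  qed simp
  finally have "2 * (\<Sum>i<p. qr_vec a b c i) = (\<Sum>i<p. qr_vec a b c i + qr_vec a c b i)"
    by (simp add: sum.distrib)
  also have "\<dots> = (\<Sum>i<p. if i = 0 then 2 * a else b + c)"
    by (rule sum.cong) (auto simp: qr_vec_def)
  also have "\<dots> = (\<Sum>i<p. (b + c) + (if i = 0 then 2 * a - (b + c) else 0))"
    by (rule sum.cong) auto
  also have "\<dots> = 2 * a + (b + c) * (int p - 1)"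
    using p_gt_1 by (simp add: sum.distrib algebra_simps)
  finally show ?thesis .
qed

text \<open>
The three elements sum to 1 by comparing coefficients. Orthogonality to the multiple \<open>j\<close> of the all-one
vector amounts to the vanishing of the coefficient sum \<open>S\<close> of \<open>e\<close>. The hypotheses determine
only \<open>2 S \<equiv> 0\<close>, but \<open>S\<close> is itself idempotent because taking the coefficient sum is a ring homomorphism;
so \<open>2\<^sup>m\<close> divides \<open>S (S - 1)\<close>, where \<open>S - 1\<close> is odd. The remaining relations follow from these by
multiplying the equation \<open>e + f + j = 1\<close> with \<open>e\<close> and with \<open>f\<close>.
\<close>
lemma orthogonal_idempotents:
  assumes m2: "2 \<le> m" and p: "prime p" "p mod 4 = 3"
    and idem: "of_vec (qr_vec a b c) \<otimes>\<^bsub>Rp m p\<^esub> of_vec (qr_vec a b c) = of_vec (qr_vec a b c)"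
    and abc: "[2 * a - (b + c) = 1] (mod 2 ^ m)" and bc: "[b + c = - int p] (mod 2 ^ m)"
    and p2: "[(int p)\<^sup>2 = 1] (mod 2 ^ m)"
  defines "e \<equiv> of_vec (qr_vec a b c)" and "f \<equiv> of_vec (qr_vec a c b)" and "j \<equiv> of_vec (\<lambda>_. int p)"
  shows "e \<oplus>\<^bsub>Rp m p\<^esub> f \<oplus>\<^bsub>Rp m p\<^esub> j = \<one>\<^bsub>Rp m p\<^esub>"
    and "e \<otimes>\<^bsub>Rp m p\<^esub> j = \<zero>\<^bsub>Rp m p\<^esub>" and "f \<otimes>\<^bsub>Rp m p\<^esub> j = \<zero>\<^bsub>Rp m p\<^esub>"
    and "j \<otimes>\<^bsub>Rp m p\<^esub> j = j"
    and "e \<otimes>\<^bsub>Rp m p\<^esub> f = \<zero>\<^bsub>Rp m p\<^esub>" and "f \<otimes>\<^bsub>Rp m p\<^esub> f = f"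
proof -
  have closed: "e \<in> carrier (Rp m p)" "f \<in> carrier (Rp m p)" "j \<in> carrier (Rp m p)"
    by (simp_all add: e_def f_def j_def)
  have aug: "[(\<Sum>i<p. qr_vec a b c i) = 0] (mod 2 ^ m)"
  proof -
    let ?S = "\<Sum>i<p. qr_vec a b c i"
    have "2 * ?S = (2 * a - (b + c)) + (b + c) * int p"
      unfolding sum_qr_vec[OF p] by (simp add: algebra_simps)
    also have "[\<dots> = 1 + (- int p) * int p] (mod 2 ^ m)"
      using abc bc by (intro cong_add cong_mult cong_refl)
    also have "[1 + (- int p) * int p = 1 - 1] (mod 2 ^ m)"
      using cong_diff[OF cong_refl[of 1] p2] by (simp add: power2_eq_square)
    finally have two: "2 ^ m dvd 2 * ?S" by (simp add: cong_0_iff)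
    then have "2 * 2 dvd 2 * ?S"
      using m2 by (metis dvd_trans le_imp_power_dvd power2_eq_square)
    then have even: "even ?S" by (simp only: dvd_mult_cancel_left) simp
    \<comment> \<open>The product with the all-one vector reads off the coefficient sum.\<close>
    have "of_vec (\<lambda>_. ?S * ?S) = of_vec (qr_vec a b c) \<otimes>\<^bsub>Rp m p\<^esub> (of_vec (qr_vec a b c) \<otimes>\<^bsub>Rp m p\<^esub> of_vec (\<lambda>_. 1))"
      by (simp add: of_vec_mult conv_constant)
    also have "\<dots> = of_vec (\<lambda>_. ?S)"
      by (subst R.m_assoc[symmetric]) (simp_all only: of_vec_closed idem, simp add: of_vec_mult conv_constant)
    finally have "[?S * ?S = ?S] (mod 2 ^ m)" using p_gt_1 by (auto simp: of_vec_eq_iff)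
    then have "2 ^ m dvd ?S * (?S - 1)" by (simp add: cong_iff_dvd_diff algebra_simps)
    moreover have "coprime (2 ^ m) (?S - 1)" using even by simp
    ultimately show ?thesis by (simp add: coprime_dvd_mult_left_iff cong_0_iff)
  qed
  have aug': "[(\<Sum>i<p. qr_vec a c b i) = 0] (mod 2 ^ m)"
  proof -
    have "2 * (\<Sum>i<p. qr_vec a c b i) = 2 * (\<Sum>i<p. qr_vec a b c i)"
      by (simp only: sum_qr_vec[OF p] add.commute)
    then show ?thesis using aug by simp
  qed
  show sum: "e \<oplus>\<^bsub>Rp m p\<^esub> f \<oplus>\<^bsub>Rp m p\<^esub> j = \<one>\<^bsub>Rp m p\<^esub>"
    unfolding e_def f_def j_def of_vec_add one_eq_of_vec
  proof (rule of_vec_cong)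
    fix i
    have bcp: "[b + c + int p = 0] (mod 2 ^ m)"
      using cong_add[OF bc cong_refl[of "int p"]] by simp
    have "[(2 * a - (b + c)) + (b + c + int p) = 1 + 0] (mod 2 ^ m)"
      using abc bcp by (rule cong_add)
    then have "[2 * a + int p = 1] (mod 2 ^ m)" by simp
    then show "[qr_vec a b c i + qr_vec a c b i + int p = delta 0 i] (mod 2 ^ m)"
      using bcp by (simp add: qr_vec_def delta_def add.commute)
  qed
  show ej: "e \<otimes>\<^bsub>Rp m p\<^esub> j = \<zero>\<^bsub>Rp m p\<^esub>"
    unfolding e_def j_def of_vec_mult conv_constant of_vec_zero[symmetric]
    using cong_scalar_right[OF aug, of "int p"] by (intro of_vec_cong) simp
  show fj: "f \<otimes>\<^bsub>Rp m p\<^esub> j = \<zero>\<^bsub>Rp m p\<^esub>"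
    unfolding f_def j_def of_vec_mult conv_constant of_vec_zero[symmetric]
    using cong_scalar_right[OF aug', of "int p"] by (intro of_vec_cong) simp
  show "j \<otimes>\<^bsub>Rp m p\<^esub> j = j"
    unfolding j_def of_vec_mult conv_constant
    using cong_scalar_right[OF p2, of "int p"] by (intro of_vec_cong) (simp add: power2_eq_square)
  have "e = e \<otimes>\<^bsub>Rp m p\<^esub> (e \<oplus>\<^bsub>Rp m p\<^esub> f \<oplus>\<^bsub>Rp m p\<^esub> j)" using closed sum by simp
  also have "\<dots> = e \<oplus>\<^bsub>Rp m p\<^esub> e \<otimes>\<^bsub>Rp m p\<^esub> f"
    using closed ej idem by (simp add: R.r_distr flip: e_def)
  finally show ef: "e \<otimes>\<^bsub>Rp m p\<^esub> f = \<zero>\<^bsub>Rp m p\<^esub>"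
    using closed R.add.r_cancel_one'[of e "e \<otimes>\<^bsub>Rp m p\<^esub> f"] by simp
  have "f = f \<otimes>\<^bsub>Rp m p\<^esub> (e \<oplus>\<^bsub>Rp m p\<^esub> f \<oplus>\<^bsub>Rp m p\<^esub> j)" using closed sum by simp
  also have "\<dots> = f \<otimes>\<^bsub>Rp m p\<^esub> f"
    using closed fj ef R.m_comm[of e f] by (simp add: R.r_distr)
  finally show "f \<otimes>\<^bsub>Rp m p\<^esub> f = f" by (rule sym)
qed

end

section \<open>Quadratic residue codes and their duals\<close>

theorem mainTheorem2:
  fixes m k p :: nat and \<alpha> \<beta> \<gamma> :: int
    and Q Q' N N' H :: "(nat \<Rightarrow> int) set set"
    and kh :: "(nat \<Rightarrow> int) set"
  assumes "m \<ge> 4" and "1 \<le> k" and "k \<le> 2 ^ (m - 3) - 1"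
    and "prime p" and "odd p"
    and "[int p = 1] (mod 8) \<or> [int p = - 1] (mod 8)"
    and "[int p = 8 * int k - 1] (mod 2 ^ m)"
    and "\<alpha> \<in> carrier (Zmod m)" and "\<beta> \<in> carrier (Zmod m)" and "\<gamma> \<in> carrier (Zmod m)"
    and "idempotent (Rp m p) (comb m p \<alpha> \<beta> \<gamma>)"
    and "[2 * \<alpha> - (\<beta> + \<gamma>) = 1] (mod 2 ^ m)"
    and "[\<beta> + \<gamma> = - int p] (mod 2 ^ m)"
    and "[(int p)\<^sup>2 = 1] (mod 2 ^ m)"
    and "kh = const m p (8 * int k - 1) \<otimes>\<^bsub>Rp m p\<^esub> allone m p"
    and "H = Idl\<^bsub>Rp m p\<^esub> {kh}"
    and "Q = Idl\<^bsub>Rp m p\<^esub> {comb m p \<alpha> \<beta> \<gamma>}"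
    and "Q' = Idl\<^bsub>Rp m p\<^esub> {comb m p \<alpha> \<beta> \<gamma> \<oplus>\<^bsub>Rp m p\<^esub> kh}"
    and "N = Idl\<^bsub>Rp m p\<^esub> {comb m p \<alpha> \<gamma> \<beta>}"
    and "N' = Idl\<^bsub>Rp m p\<^esub> {comb m p \<alpha> \<gamma> \<beta> \<oplus>\<^bsub>Rp m p\<^esub> kh}"
  shows "(equivalent_codes p (codewords m p Q) (codewords m p N)
          \<and> equivalent_codes p (codewords m p Q') (codewords m p N'))
       \<and> (Q' \<inter> N' = H \<and> Q' <+>\<^bsub>Rp m p\<^esub> N' = carrier (Rp m p))
       \<and> (card Q' = 2 ^ (m * ((p + 1) div 2)) \<and> card N' = 2 ^ (m * ((p + 1) div 2)))
       \<and> (Q' = Q <+>\<^bsub>Rp m p\<^esub> H \<and> N' = N <+>\<^bsub>Rp m p\<^esub> H)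
       \<and> (card Q = 2 ^ (m * ((p - 1) div 2)) \<and> card N = 2 ^ (m * ((p - 1) div 2)))
       \<and> (self_orthogonal m p (codewords m p Q) \<and> self_orthogonal m p (codewords m p N)
          \<and> dual_code m p (codewords m p Q') = codewords m p Q
          \<and> dual_code m p (codewords m p N') = codewords m p N)"
proof -
  interpret cyclic_quotient m p
    using assms(1) prime_gt_1_nat[OF assms(4)] by unfold_locales auto
  note p = assms(4)
  have p34: "p mod 4 = 3"
  proof -
    have "(4 :: int) dvd 2 ^ m"
      using assms(1) le_imp_power_dvd[of 2 m "2 :: int"] by simp
    then have "[int p = 8 * int k - 1] (mod 4)" using assms(7) by (rule cong_dvd_modulus[rotated])
    then have "int p mod 4 = 3" unfolding cong_def by presburger
    then show ?thesis by presburger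
  qed
  let ?a = "qr_vec \<alpha> \<beta> \<gamma>" and ?b = "qr_vec \<alpha> \<gamma> \<beta>"
  define e f j where "e = of_vec ?a" and "f = of_vec ?b" and "j = of_vec (\<lambda>_. int p)"
  have closed [simp]: "e \<in> carrier (Rp m p)" "f \<in> carrier (Rp m p)" "j \<in> carrier (Rp m p)"
    by (simp_all add: e_def f_def j_def)
  have comb: "comb m p \<alpha> \<beta> \<gamma> = e" "comb m p \<alpha> \<gamma> \<beta> = f"
    using assms(8-10) by (simp_all add: comb_eq_of_vec e_def f_def)
  have kh: "kh = j"
  proof -
    \<comment> \<open>The bounds on \<open>k\<close> make \<open>8 k - 1\<close> a reduced residue, as required of the argument of \<open>const\<close>.\<close>
    have "k + 1 \<le> 2 ^ (m - 3)" using assms(2,3) by simp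
    then have "int (k + 1) \<le> int (2 ^ (m - 3))" by (simp only: of_nat_le_iff)
    then have "8 * int k \<le> 8 * (2 ^ (m - 3) - 1)" by simp
    also have "\<dots> = 2 ^ m - 8"
      using assms(1) power_add[of "2::int" 3 "m - 3"] by (simp add: algebra_simps)
    finally have "8 * int k - 1 \<in> carrier (Zmod m)"
      using assms(2) by (simp add: Zmod_carrier)
    then have "kh = of_vec (\<lambda>_. 8 * int k - 1)"
      using assms(15) by (simp add: allone_eq_of_vec const_mult_of_vec)
    also have "\<dots> = j"
      unfolding j_def using assms(7) by (intro of_vec_cong) (rule cong_sym)
    finally show ?thesis .
  qed
  have ee: "e \<otimes>\<^bsub>Rp m p\<^esub> e = e"
    using assms(11) comb by (simp add: idempotent_def)
  have m2: "2 \<le> m" using assms(1) by simp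
  note orth = orthogonal_idempotents[OF m2 p p34 ee[unfolded e_def] assms(12-14), folded e_def f_def j_def]
  note sum1 = orth(1) and ej = orth(2) and fj = orth(3) and jj = orth(4) and ef = orth(5) and ff = orth(6)
  have fe: "f \<otimes>\<^bsub>Rp m p\<^esub> e = \<zero>\<^bsub>Rp m p\<^esub>" using ef by (simp add: R.m_comm)
  have ideals: "Q = PIdl\<^bsub>Rp m p\<^esub> e" "N = PIdl\<^bsub>Rp m p\<^esub> f" "H = PIdl\<^bsub>Rp m p\<^esub> j"
    "Q' = PIdl\<^bsub>Rp m p\<^esub> (e \<oplus>\<^bsub>Rp m p\<^esub> j)" "N' = PIdl\<^bsub>Rp m p\<^esub> (f \<oplus>\<^bsub>Rp m p\<^esub> j)"
    unfolding assms(16-20) comb kh by (simp_all add: R.cgenideal_eq_genideal)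
  have of_vec_Q': "e \<oplus>\<^bsub>Rp m p\<^esub> j = of_vec (\<lambda>i. ?a i + int p)" "f \<oplus>\<^bsub>Rp m p\<^esub> j = of_vec (\<lambda>i. ?b i + int p)"
    by (simp_all add: e_def f_def j_def of_vec_add)
  have negs: "of_vec (?a \<circ> neg) = f" "of_vec (?b \<circ> neg) = e"
    unfolding e_def f_def by (rule of_vec_qr_neg[OF p p34])+
  have negs': "of_vec ((\<lambda>i. ?a i + int p) \<circ> neg) = f \<oplus>\<^bsub>Rp m p\<^esub> j"
    "of_vec ((\<lambda>i. ?b i + int p) \<circ> neg) = e \<oplus>\<^bsub>Rp m p\<^esub> j"
    unfolding negs[symmetric] j_def of_vec_add by (simp_all add: comp_def)

  have one: "equivalent_codes p (codewords m p Q) (codewords m p N)"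
    "equivalent_codes p (codewords m p Q') (codewords m p N')"
    using equivalent_codes_neg[of ?a] equivalent_codes_neg[of "\<lambda>i. ?a i + int p"]
    unfolding ideals of_vec_Q'(1) negs negs' by (simp_all add: e_def)

  have four: "Q' = Q <+>\<^bsub>Rp m p\<^esub> H" "N' = N <+>\<^bsub>Rp m p\<^esub> H"
    unfolding ideals using ee ff jj ej fj by (simp_all add: R.cgenideal_orthogonal_add)

  have two1: "Q' \<inter> N' = H"
    unfolding ideals using ee ff jj ef ej fj by (intro R.cgenideal_orthogonal_Int) simp_all
  have two2: "Q' <+>\<^bsub>Rp m p\<^esub> N' = carrier (Rp m p)"
  proof
    show "Q' <+>\<^bsub>Rp m p\<^esub> N' \<subseteq> carrier (Rp m p)"
      unfolding ideals by (intro R.set_add_closed PIdl_subset R.a_closed closed)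
    show "carrier (Rp m p) \<subseteq> Q' <+>\<^bsub>Rp m p\<^esub> N'"
    proof
      fix x assume x: "x \<in> carrier (Rp m p)"
      have mem: "x \<otimes>\<^bsub>Rp m p\<^esub> (e \<oplus>\<^bsub>Rp m p\<^esub> j) \<in> Q'" "(x \<otimes>\<^bsub>Rp m p\<^esub> f) \<otimes>\<^bsub>Rp m p\<^esub> (f \<oplus>\<^bsub>Rp m p\<^esub> j) \<in> N'"
        unfolding ideals cgenideal_def using x by auto
      have "x = x \<otimes>\<^bsub>Rp m p\<^esub> (e \<oplus>\<^bsub>Rp m p\<^esub> f \<oplus>\<^bsub>Rp m p\<^esub> j)" using x sum1 by simp
      also have "\<dots> = x \<otimes>\<^bsub>Rp m p\<^esub> (e \<oplus>\<^bsub>Rp m p\<^esub> j) \<oplus>\<^bsub>Rp m p\<^esub> (x \<otimes>\<^bsub>Rp m p\<^esub> f) \<otimes>\<^bsub>Rp m p\<^esub> (f \<oplus>\<^bsub>Rp m p\<^esub> j)"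
        using x ff fj by (simp add: R.r_distr R.m_assoc R.a_ac)
      finally show "x \<in> Q' <+>\<^bsub>Rp m p\<^esub> N'"
        using mem unfolding set_add_def' by blast
    qed
  qed

  have cardN: "card N = card Q"
    unfolding ideals using card_PIdl_neg[of ?a] unfolding negs by (simp add: e_def)
  have odd: "odd p" by (rule assms(5))
  have cardH: "card H = 2 ^ m"
    unfolding ideals j_def
  proof (rule card_PIdl_constant)
    show "coprime (int p) (2 ^ m)" using odd by simp
  qed
  have cardQ': "card Q' = card Q * 2 ^ m" "card N' = card N * 2 ^ m"
    using R.card_cgenideal_orthogonal_add[of e j] R.card_cgenideal_orthogonal_add[of f j]
      ee ff jj ej fj cardH unfolding ideals by simp_all
  have "2 ^ (m * p) = card Q * card N * 2 ^ m"
  proof -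
    have efj: "(e \<oplus>\<^bsub>Rp m p\<^esub> f) \<otimes>\<^bsub>Rp m p\<^esub> j = \<zero>\<^bsub>Rp m p\<^esub>" using ej fj by (simp add: R.l_distr)
    have "PIdl\<^bsub>Rp m p\<^esub> \<one>\<^bsub>Rp m p\<^esub> = carrier (Rp m p)"
      by (subst R.cgenideal_idempotent) auto
    then have "card (carrier (Rp m p)) = card (PIdl\<^bsub>Rp m p\<^esub> (e \<oplus>\<^bsub>Rp m p\<^esub> f \<oplus>\<^bsub>Rp m p\<^esub> j))"
      by (simp only: sum1)
    also have "\<dots> = card (PIdl\<^bsub>Rp m p\<^esub> (e \<oplus>\<^bsub>Rp m p\<^esub> f)) * card H"
      unfolding ideals using efj jj R.orthogonal_idempotent_add[of e f] ee ff ef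
      by (intro R.card_cgenideal_orthogonal_add) simp_all
    also have "card (PIdl\<^bsub>Rp m p\<^esub> (e \<oplus>\<^bsub>Rp m p\<^esub> f)) = card Q * card N"
      unfolding ideals using ee ff ef by (intro R.card_cgenideal_orthogonal_add) simp_all
    finally show ?thesis by (simp add: card_Rp cardH)
  qed
  \<comment> \<open>Since the two ideals have the same cardinality, the count determines its square.\<close>
  moreover have "m * p = 2 * (m * ((p - 1) div 2)) + m"
    using odd by (auto elim!: oddE simp: algebra_simps)
  ultimately have "(card Q)\<^sup>2 = (2 ^ (m * ((p - 1) div 2)))\<^sup>2"
    unfolding cardN by (simp only: power_add power_even_eq) (simp add: power2_eq_square)
  then have cardQ: "card Q = 2 ^ (m * ((p - 1) div 2))"
    by (rule power2_eq_imp_eq) simp_all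
  have expo: "m * ((p + 1) div 2) = m * ((p - 1) div 2) + m"
    using odd by (auto elim!: oddE simp: algebra_simps)
  have three: "card Q' = 2 ^ (m * ((p + 1) div 2))" "card N' = 2 ^ (m * ((p + 1) div 2))"
    unfolding cardQ' cardN cardQ expo by (simp_all add: power_add)

  have memQ: "of_vec u \<in> Q \<longleftrightarrow> of_vec u \<otimes>\<^bsub>Rp m p\<^esub> e = of_vec u"
    and memN: "of_vec u \<in> N \<longleftrightarrow> of_vec u \<otimes>\<^bsub>Rp m p\<^esub> f = of_vec u" for u
    unfolding ideals using ee ff by (simp_all add: R.cgenideal_idempotent)
  have dualQ: "dual_code m p (codewords m p Q) = {u \<in> vectors m p. of_vec u \<otimes>\<^bsub>Rp m p\<^esub> f = \<zero>\<^bsub>Rp m p\<^esub>}"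
    using dual_code_PIdl[of ?a] unfolding ideals negs by (simp add: e_def)
  have dualN: "dual_code m p (codewords m p N) = {u \<in> vectors m p. of_vec u \<otimes>\<^bsub>Rp m p\<^esub> e = \<zero>\<^bsub>Rp m p\<^esub>}"
    using dual_code_PIdl[of ?b] unfolding ideals negs by (simp add: f_def)
  have dualQ': "dual_code m p (codewords m p Q')
      = {u \<in> vectors m p. of_vec u \<otimes>\<^bsub>Rp m p\<^esub> (f \<oplus>\<^bsub>Rp m p\<^esub> j) = \<zero>\<^bsub>Rp m p\<^esub>}"
    using dual_code_PIdl[of "\<lambda>i. ?a i + int p"] unfolding ideals negs' of_vec_Q'(1) .
  have dualN': "dual_code m p (codewords m p N')
      = {u \<in> vectors m p. of_vec u \<otimes>\<^bsub>Rp m p\<^esub> (e \<oplus>\<^bsub>Rp m p\<^esub> j) = \<zero>\<^bsub>Rp m p\<^esub>}"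
    using dual_code_PIdl[of "\<lambda>i. ?b i + int p"] unfolding ideals negs' of_vec_Q'(2) .
  \<comment> \<open>The annihilator of \<open>1 - a\<close> is the set of elements fixed by \<open>a\<close>.\<close>
  have annih: "x \<otimes>\<^bsub>Rp m p\<^esub> b = \<zero>\<^bsub>Rp m p\<^esub> \<longleftrightarrow> x \<otimes>\<^bsub>Rp m p\<^esub> a = x"
    if "x \<in> carrier (Rp m p)" "a \<in> carrier (Rp m p)" "b \<in> carrier (Rp m p)"
      "a \<oplus>\<^bsub>Rp m p\<^esub> b = \<one>\<^bsub>Rp m p\<^esub>" for x a b
  proof -
    have "x \<otimes>\<^bsub>Rp m p\<^esub> a \<oplus>\<^bsub>Rp m p\<^esub> x \<otimes>\<^bsub>Rp m p\<^esub> b = x"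
      using that by (simp flip: R.r_distr)
    then show ?thesis
      using that R.add.r_cancel_one[of x "x \<otimes>\<^bsub>Rp m p\<^esub> b"] by auto
  qed
  have sumQ: "e \<oplus>\<^bsub>Rp m p\<^esub> (f \<oplus>\<^bsub>Rp m p\<^esub> j) = \<one>\<^bsub>Rp m p\<^esub>" "f \<oplus>\<^bsub>Rp m p\<^esub> (e \<oplus>\<^bsub>Rp m p\<^esub> j) = \<one>\<^bsub>Rp m p\<^esub>"
    using sum1 by (simp_all add: R.a_ac)
  have six1: "dual_code m p (codewords m p Q') = codewords m p Q"
    unfolding dualQ' using annih[OF _ _ _ sumQ(1)] by (auto simp: mem_codewords memQ)
  have six2: "dual_code m p (codewords m p N') = codewords m p N"
    unfolding dualN' using annih[OF _ _ _ sumQ(2)] by (auto simp: mem_codewords memN)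
  have six3: "self_orthogonal m p (codewords m p Q)"
    unfolding self_orthogonal_def dualQ
  proof
    fix u assume "u \<in> codewords m p Q"
    then have u: "u \<in> vectors m p" "of_vec u \<otimes>\<^bsub>Rp m p\<^esub> e = of_vec u" by (auto simp: mem_codewords memQ)
    have "of_vec u \<otimes>\<^bsub>Rp m p\<^esub> f = of_vec u \<otimes>\<^bsub>Rp m p\<^esub> (e \<otimes>\<^bsub>Rp m p\<^esub> f)"
      using u(2) by (simp flip: R.m_assoc)
    then show "u \<in> {u \<in> vectors m p. of_vec u \<otimes>\<^bsub>Rp m p\<^esub> f = \<zero>\<^bsub>Rp m p\<^esub>}"
      using u ef by simp
  qed
  have six4: "self_orthogonal m p (codewords m p N)"
    unfolding self_orthogonal_def dualN
  proof
    fix u assume "u \<in> codewords m p N"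
    then have u: "u \<in> vectors m p" "of_vec u \<otimes>\<^bsub>Rp m p\<^esub> f = of_vec u" by (auto simp: mem_codewords memN)
    have "of_vec u \<otimes>\<^bsub>Rp m p\<^esub> e = of_vec u \<otimes>\<^bsub>Rp m p\<^esub> (f \<otimes>\<^bsub>Rp m p\<^esub> e)"
      using u(2) by (simp flip: R.m_assoc)
    then show "u \<in> {u \<in> vectors m p. of_vec u \<otimes>\<^bsub>Rp m p\<^esub> e = \<zero>\<^bsub>Rp m p\<^esub>}"
      using u fe by simp
  qed
  show ?thesis
    using one two1 two2 three four cardQ cardN six1 six2 six3 six4 by simp
qed

end
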